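(* For $\gamma>0$ let $u_\gamma$ be the solution of $$\min_{u\in U_{\mathrm{ad}}}\ \tfrac12\|Ku-z\|_Y^2+\alpha G(u)+\tfrac\gamma2\|u\|_{L^2(\Omega)}^2\qquad(P_\gamma)$$ with state $y_\gamma:=Ku_\gamma$, and for $\gamma>0$, $h\ge0$ let $u_{\gamma,h}$ be the solution of $$\min_{u\in U_{\mathrm{ad}}}\ \tfrac12\|K_hu-z\|_Y^2+\alpha G(u)+\tfrac\gamma2\|u\|_{L^2(\Omega)}^2\qquad(P_{\gamma,h})$$ with state $y_{\gamma,h}:=K_hu_{\gamma,h}$. Assume that for all $h>0$ the estimate $$\|(K-K_h)u_{\gamma,h}\|_Y+\|(K^*-K_h^* )(y_{\gamma,h}-z)\|_{L^2(\Omega)}\le\delta(h)$$ holds for all $\gamma>0$, where $\delta:[0,\infty)\to\mathbb{R}$ is a monotonically increasing function (not depending on $\gamma$) with $\delta(0)=0$. Then for all $\gamma>0$ and $h\ge0$ $$\|y_\gamma-y_{\gamma,h}\|_Y^2+\gamma\|u_\gamma-u_{\gamma,h}\|_{L^2(\Omega)}^2\le(1+\gamma^{-1})\,\delta(h)^2 .$$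
   Context: Setting: $\Omega\subset\mathbb{R}^n$ is a bounded domain, $Y$ is a (real) Hilbert space, $K:L^2(\Omega)\to Y$ is linear and continuous with adjoint $K^*:Y\to L^2(\Omega)$, $z\in Y$, $\alpha>0$, and $u_1<u_2<\dots<u_d$ are given real numbers, $d\ge2$. Define $g:\mathbb{R}\to\mathbb{R}\cup\{\infty\}$ by $g(v)=\frac12\big((u_i+u_{i+1})v-u_iu_{i+1}\big)$ if $v\in[u_i,u_{i+1}]$, $1\le i<d$, and $g(v)=\infty$ if $v\notin[u_1,u_d]$. Set $G(u)=\int_\Omega g(u(x))\,dx$ for $u\in L^2(\Omega)$, and $U_{\mathrm{ad}}=\{u\in L^2(\Omega): u_1\le u(x)\le u_d \text{ for a.e. } x\in\Omega\}$. For every $h>0$, $K_h:L^2(\Omega)\to Y$ is a linear continuous operator (a discretization of $K$) whose range $Y_h\subset Y$ is finite dimensional; $K_h^*:Y\to L^2(\Omega)$ is its adjoint. For $h=0$ the convention is $K_0:=K$. *)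

theory Defs
  imports "HOL-Analysis.Analysis"
begin

text \<open>
  Elements of \<open>L\<^sup>2(\<Omega>)\<close> are represented by square-integrable functions, not by their
  almost-everywhere classes; values outside \<open>\<Omega>\<close> play no role.  Thus
  \<open>L2_norm\<close> is a seminorm on representatives, which vanishes exactly for the functions that are
  zero almost everywhere.
\<close>

definition L2 :: "'a::euclidean_space set \<Rightarrow> ('a \<Rightarrow> real) set" where
  "L2 \<Omega> = {u \<in> borel_measurable (lebesgue_on \<Omega>). integrable (lebesgue_on \<Omega>) (\<lambda>x. (u x)\<^sup>2)}"

definition L2_inner :: "'a::euclidean_space set \<Rightarrow> ('a \<Rightarrow> real) \<Rightarrow> ('a \<Rightarrow> real) \<Rightarrow> real" where
  "L2_inner \<Omega> u v = (\<integral>x. u x * v x \<partial>(lebesgue_on \<Omega>))"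

definition L2_norm :: "'a::euclidean_space set \<Rightarrow> ('a \<Rightarrow> real) \<Rightarrow> real" where
  "L2_norm \<Omega> u = sqrt (L2_inner \<Omega> u u)"

text \<open>
  Linearity together with the bound makes \<open>K\<close> constant on almost-everywhere classes (see
  \<open>L2_bounded_linear_cong_AE\<close> below), so that these are exactly the bounded operators on the
  quotient.
\<close>

definition L2_bounded_linear ::
    "'a::euclidean_space set \<Rightarrow> (('a \<Rightarrow> real) \<Rightarrow> 'y::real_normed_vector) \<Rightarrow> bool" where
  "L2_bounded_linear \<Omega> K \<longleftrightarrow>
     (\<forall>u\<in>L2 \<Omega>. \<forall>v\<in>L2 \<Omega>. K (\<lambda>x. u x + v x) = K u + K v) \<and>
     (\<forall>c. \<forall>u\<in>L2 \<Omega>. K (\<lambda>x. c * u x) = c *\<^sub>R K u) \<and>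
     (\<exists>C. \<forall>u\<in>L2 \<Omega>. norm (K u) \<le> C * L2_norm \<Omega> u)"

text \<open>The adjoint is determined up to equality almost everywhere of its values.\<close>

definition is_L2_adjoint ::
    "'a::euclidean_space set \<Rightarrow> (('a \<Rightarrow> real) \<Rightarrow> 'y::real_inner) \<Rightarrow> ('y \<Rightarrow> 'a \<Rightarrow> real) \<Rightarrow> bool" where
  "is_L2_adjoint \<Omega> K K' \<longleftrightarrow>
     (\<forall>y. K' y \<in> L2 \<Omega>) \<and> (\<forall>u\<in>L2 \<Omega>. \<forall>y. K u \<bullet> y = L2_inner \<Omega> u (K' y))"

definition finite_dim_range ::
    "'a::euclidean_space set \<Rightarrow> (('a \<Rightarrow> real) \<Rightarrow> 'y::real_vector) \<Rightarrow> bool" where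
  "finite_dim_range \<Omega> K \<longleftrightarrow> (\<exists>B. finite B \<and> K ` L2 \<Omega> \<subseteq> span B)"

text \<open>
  The control values are \<open>a 1 < \<dots> < a d\<close>.  At a common endpoint of two
  adjacent intervals both formulas give \<open>v\<^sup>2 / 2\<close>, so the choice of the least index is immaterial
  (see \<open>multibang_eq\<close>).
\<close>

definition multibang :: "nat \<Rightarrow> (nat \<Rightarrow> real) \<Rightarrow> real \<Rightarrow> ereal" where
  "multibang d a v =
     (if v \<in> {a 1..a d}
      then (let i = (LEAST i. 1 \<le> i \<and> i < d \<and> v \<in> {a i..a (i + 1)})
            in ereal (1/2 * ((a i + a (i + 1)) * v - a i * a (i + 1))))
      else \<infinity>)"

text \<open>
  The extended-valued integral, as the difference of the integrals of the positive and
  negative parts (\<open>e2ennreal\<close> maps negative numbers to 0).  Since \<open>multibang d a\<close> is bounded below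
  and \<open>\<Omega>\<close> has finite measure, the subtrahend is finite.
\<close>

definition multibang_integral ::
    "'a::euclidean_space set \<Rightarrow> nat \<Rightarrow> (nat \<Rightarrow> real) \<Rightarrow> ('a \<Rightarrow> real) \<Rightarrow> ereal" where
  "multibang_integral \<Omega> d a u =
     enn2ereal (\<integral>\<^sup>+x. e2ennreal (multibang d a (u x)) \<partial>(lebesgue_on \<Omega>)) -
     enn2ereal (\<integral>\<^sup>+x. e2ennreal (- multibang d a (u x)) \<partial>(lebesgue_on \<Omega>))"

definition U_ad :: "'a::euclidean_space set \<Rightarrow> nat \<Rightarrow> (nat \<Rightarrow> real) \<Rightarrow> ('a \<Rightarrow> real) set" where
  "U_ad \<Omega> d a = {u \<in> L2 \<Omega>. AE x in lebesgue_on \<Omega>. a 1 \<le> u x \<and> u x \<le> a d}"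

definition objective ::
    "'a::euclidean_space set \<Rightarrow> nat \<Rightarrow> (nat \<Rightarrow> real) \<Rightarrow> (('a \<Rightarrow> real) \<Rightarrow> 'y::real_normed_vector) \<Rightarrow>
     'y \<Rightarrow> real \<Rightarrow> real \<Rightarrow> ('a \<Rightarrow> real) \<Rightarrow> ereal" where
  "objective \<Omega> d a K z \<alpha> \<gamma> u =
     ereal (1/2 * (norm (K u - z))\<^sup>2) + ereal \<alpha> * multibang_integral \<Omega> d a u
       + ereal (\<gamma>/2 * (L2_norm \<Omega> u)\<^sup>2)"

definition is_solution ::
    "'a::euclidean_space set \<Rightarrow> nat \<Rightarrow> (nat \<Rightarrow> real) \<Rightarrow> (('a \<Rightarrow> real) \<Rightarrow> 'y::real_normed_vector) \<Rightarrow>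
     'y \<Rightarrow> real \<Rightarrow> real \<Rightarrow> ('a \<Rightarrow> real) \<Rightarrow> bool" where
  "is_solution \<Omega> d a K z \<alpha> \<gamma> u \<longleftrightarrow>
     is_arg_min (objective \<Omega> d a K z \<alpha> \<gamma>) (\<lambda>v. v \<in> U_ad \<Omega> d a) u"

lemma L2_bounded_linear_cong_AE:
  assumes K: "L2_bounded_linear \<Omega> K" and u: "u \<in> L2 \<Omega>" and v: "v \<in> L2 \<Omega>"
    and ae: "AE x in lebesgue_on \<Omega>. u x = v x"
  shows "K u = K v"
proof -
  have add: "\<And>u v. u \<in> L2 \<Omega> \<Longrightarrow> v \<in> L2 \<Omega> \<Longrightarrow> K (\<lambda>x. u x + v x) = K u + K v"
    using K by (auto simp: L2_bounded_linear_def)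
  obtain C where C: "\<And>u. u \<in> L2 \<Omega> \<Longrightarrow> norm (K u) \<le> C * L2_norm \<Omega> u"
    using K unfolding L2_bounded_linear_def by blast
  let ?w = "\<lambda>x. u x - v x"
  have meas: "u \<in> borel_measurable (lebesgue_on \<Omega>)" "v \<in> borel_measurable (lebesgue_on \<Omega>)"
    using u v by (auto simp: L2_def)
  have ae0: "AE x in lebesgue_on \<Omega>. (?w x)\<^sup>2 = 0"
    using ae by eventually_elim simp
  have "integrable (lebesgue_on \<Omega>) (\<lambda>x. (?w x)\<^sup>2) \<longleftrightarrow> integrable (lebesgue_on \<Omega>) (\<lambda>x. 0::real)"
    by (rule integrable_cong_AE) (use meas ae0 in auto)
  then have w: "?w \<in> L2 \<Omega>"
    using meas by (auto simp: L2_def)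
  have "L2_inner \<Omega> ?w ?w = (\<integral>x. 0 \<partial>(lebesgue_on \<Omega>))"
    unfolding L2_inner_def
    by (rule integral_cong_AE) (use meas ae0 in \<open>auto simp: power2_eq_square\<close>)
  then have "K ?w = 0"
    using C[OF w] by (simp add: L2_norm_def)
  then show ?thesis
    using add[OF w v] by simp
qed

lemma multibang_eq:
  assumes a: "strict_mono_on {1..d} a" and i: "1 \<le> i" "i < d" and v: "v \<in> {a i..a (i + 1)}"
  shows "multibang d a v = ereal (1/2 * ((a i + a (i + 1)) * v - a i * a (i + 1)))"
proof -
  have le: "a j \<le> a k" if "1 \<le> j" "j \<le> k" "k \<le> d" for j k
    using strict_mono_on_leD[OF a, of j k] that by auto
  have lt: "a j < a k" if "1 \<le> j" "j < k" "k \<le> d" for j k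
    using strict_mono_onD[OF a, of j k] that by auto
  define j where "j = (LEAST j. 1 \<le> j \<and> j < d \<and> v \<in> {a j..a (j + 1)})"
  have j: "1 \<le> j \<and> j < d \<and> v \<in> {a j..a (j + 1)}"
    unfolding j_def by (rule LeastI[where k = i]) (use i v in auto)
  have "j \<le> i"
    unfolding j_def by (rule Least_le) (use i v in auto)
  have "j = i \<or> (i = j + 1 \<and> v = a i)"
  proof (cases "j = i")
    case False
    then have "j + 1 \<le> i" using \<open>j \<le> i\<close> by simp
    have "v \<le> a (j + 1)" "a i \<le> v" using j v by auto
    moreover have "j + 1 < i \<Longrightarrow> a (j + 1) < a i" using lt[of "j + 1" i] i by simp
    ultimately show ?thesis using \<open>j + 1 \<le> i\<close> by (cases "j + 1 = i") auto
  qed simp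
  moreover have "v \<in> {a 1..a d}"
    using le[of 1 i] le[of "i + 1" d] i v by auto
  ultimately show ?thesis
    unfolding multibang_def j_def[symmetric] Let_def by (auto simp: algebra_simps)
qed

end

theory Submission
  imports Defs
begin

text \<open>
  Since \<open>g\<close> is the maximum of the chords of \<open>v\<^sup>2 / 2\<close>, it is convex and each solution satisfies a
  variational inequality.  Testing the inequality of \<open>u\<^sub>\<gamma>\<close> with \<open>u\<^sub>\<gamma>\<^sub>h\<close> and vice versa and adding them
  cancels \<open>G\<close>; rewriting the remainder with the adjoints gives
  \<open>\<parallel>y - y\<^sub>h\<parallel>\<^sup>2 + \<gamma> \<parallel>u - u\<^sub>h\<parallel>\<^sup>2 \<le> \<langle>y - y\<^sub>h, (K - K\<^sub>h) u\<^sub>h\<rangle> + \<langle>(K\<^sup>* - K\<^sub>h\<^sup>*)(y\<^sub>h - z), u\<^sub>h - u\<rangle>\<close>,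
  and Young's inequality absorbs the right-hand side.
\<close>

section \<open>Inner product calculus on square-integrable representatives\<close>

lemma L2_integrable_mult:
  assumes "u \<in> L2 \<Omega>" "v \<in> L2 \<Omega>"
  shows "integrable (lebesgue_on \<Omega>) (\<lambda>x. u x * v x)"
proof (rule Bochner_Integration.integrable_bound)
  show "integrable (lebesgue_on \<Omega>) (\<lambda>x. (u x)\<^sup>2 + (v x)\<^sup>2)"
    using assms by (auto simp: L2_def)
  show "(\<lambda>x. u x * v x) \<in> borel_measurable (lebesgue_on \<Omega>)"
    using assms by (auto simp: L2_def)
  have "\<bar>s * t\<bar> \<le> s\<^sup>2 + t\<^sup>2" for s t :: real
    using sum_squares_bound[of "\<bar>s\<bar>" "\<bar>t\<bar>"] mult_nonneg_nonneg[of "\<bar>s\<bar>" "\<bar>t\<bar>"]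
    unfolding abs_mult power2_abs by linarith
  then show "AE x in lebesgue_on \<Omega>. norm (u x * v x) \<le> norm ((u x)\<^sup>2 + (v x)\<^sup>2)"
    by simp
qed

lemma L2_add:
  assumes "u \<in> L2 \<Omega>" "v \<in> L2 \<Omega>"
  shows "(\<lambda>x. u x + v x) \<in> L2 \<Omega>"
  using assms L2_integrable_mult[OF assms] by (auto simp: L2_def power2_sum mult.assoc)

lemma L2_scale:
  assumes "u \<in> L2 \<Omega>"
  shows "(\<lambda>x. c * u x) \<in> L2 \<Omega>"
  using assms by (auto simp: L2_def power_mult_distrib)

lemma L2_diff:
  assumes "u \<in> L2 \<Omega>" "v \<in> L2 \<Omega>"
  shows "(\<lambda>x. u x - v x) \<in> L2 \<Omega>"
  using L2_add[OF assms(1) L2_scale[OF assms(2), of "-1"]] by simp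

lemma L2_inner_commute: "L2_inner \<Omega> u v = L2_inner \<Omega> v u"
  by (simp add: L2_inner_def mult.commute)

lemma L2_inner_add_right:
  assumes "u \<in> L2 \<Omega>" "v \<in> L2 \<Omega>" "w \<in> L2 \<Omega>"
  shows "L2_inner \<Omega> u (\<lambda>x. v x + w x) = L2_inner \<Omega> u v + L2_inner \<Omega> u w"
  using assms by (simp add: L2_inner_def distrib_left L2_integrable_mult)

lemma L2_inner_diff_right:
  assumes "u \<in> L2 \<Omega>" "v \<in> L2 \<Omega>" "w \<in> L2 \<Omega>"
  shows "L2_inner \<Omega> u (\<lambda>x. v x - w x) = L2_inner \<Omega> u v - L2_inner \<Omega> u w"
  using assms by (simp add: L2_inner_def right_diff_distrib L2_integrable_mult)

lemma L2_inner_scale_right: "L2_inner \<Omega> u (\<lambda>x. c * v x) = c * L2_inner \<Omega> u v"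
  by (simp add: L2_inner_def mult.left_commute)

lemma L2_norm_power2: "(L2_norm \<Omega> u)\<^sup>2 = L2_inner \<Omega> u u"
  by (simp add: L2_norm_def L2_inner_def)

lemma L2_norm_nonneg: "0 \<le> L2_norm \<Omega> u"
  by (simp add: L2_norm_def L2_inner_def)

text \<open>The expansion keeps \<open>t\<close> free: as a variable it gives the objective along a
  segment, with \<open>t = -1\<close> a polarization identity, and with
  \<open>t = - inverse \<gamma>\<close> Young's inequality.\<close>

lemma L2_norm_power2_add_scale:
  assumes "u \<in> L2 \<Omega>" "v \<in> L2 \<Omega>"
  shows "(L2_norm \<Omega> (\<lambda>x. u x + t * v x))\<^sup>2 =
    (L2_norm \<Omega> u)\<^sup>2 + 2 * t * L2_inner \<Omega> u v + t\<^sup>2 * (L2_norm \<Omega> v)\<^sup>2"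
proof -
  note tv = L2_scale[OF assms(2), of t]
  have "L2_inner \<Omega> (\<lambda>x. u x + t * v x) (\<lambda>x. u x + t * v x) =
      L2_inner \<Omega> u (\<lambda>x. u x + t * v x) + t * L2_inner \<Omega> v (\<lambda>x. u x + t * v x)"
    using L2_inner_add_right[OF L2_add[OF assms(1) tv] assms(1) tv]
    by (simp add: L2_inner_scale_right L2_inner_commute)
  then show ?thesis
    using assms tv
    by (simp add: L2_norm_power2 L2_inner_add_right L2_inner_scale_right L2_inner_commute[of \<Omega> v u]
        power2_eq_square[of t] algebra_simps)
qed

text \<open>Expand \<gamma> times the squared norm of \<open>v - inverse \<gamma> * u\<close>, which
  is nonnegative. The weight \<gamma> sits on \<open>v\<close> so that the regularization term can
  absorb it later.\<close>

lemma L2_inner_Young: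
  assumes "u \<in> L2 \<Omega>" "v \<in> L2 \<Omega>" "\<gamma> > 0"
  shows "2 * L2_inner \<Omega> u v \<le> \<gamma> * (L2_norm \<Omega> v)\<^sup>2 + inverse \<gamma> * (L2_norm \<Omega> u)\<^sup>2"
proof -
  have "0 \<le> \<gamma> * (L2_norm \<Omega> (\<lambda>x. v x + (- inverse \<gamma>) * u x))\<^sup>2"
    using assms(3) by simp
  also have "\<dots> = \<gamma> * (L2_norm \<Omega> v)\<^sup>2 - 2 * L2_inner \<Omega> u v + inverse \<gamma> * (L2_norm \<Omega> u)\<^sup>2"
    unfolding L2_norm_power2_add_scale[OF assms(2,1)]
    using assms(3) by (simp add: L2_inner_commute[of \<Omega> v u] field_simps power2_eq_square)
  finally show ?thesis by simp
qed

lemma L2_bounded_linear_add_scale: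
  assumes K: "L2_bounded_linear \<Omega> K" and u: "u \<in> L2 \<Omega>" and v: "v \<in> L2 \<Omega>"
  shows "K (\<lambda>x. u x + t * v x) = K u + t *\<^sub>R K v"
  using K u v L2_scale[OF v, of t] unfolding L2_bounded_linear_def by simp

lemma L2_bounded_linear_diff:
  assumes K: "L2_bounded_linear \<Omega> K" and u: "u \<in> L2 \<Omega>" and v: "v \<in> L2 \<Omega>"
  shows "K (\<lambda>x. u x - v x) = K u - K v"
  using L2_bounded_linear_add_scale[OF K u v, of "-1"] by simp

section \<open>The multibang penalty as a maximum of chords\<close>

definition chord :: "(nat \<Rightarrow> real) \<Rightarrow> nat \<Rightarrow> real \<Rightarrow> real" where
  "chord a i v = 1/2 * ((a i + a (i + 1)) * v - a i * a (i + 1))"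

text \<open>A real-valued substitute for \<open>multibang\<close>, from which convexity and
  measurability can be read off. The two agree only on \<open>{a 1..a d}\<close>, which suffices
  because members of \<open>U_ad\<close> take values there almost everywhere.\<close>

definition chord_max :: "nat \<Rightarrow> (nat \<Rightarrow> real) \<Rightarrow> real \<Rightarrow> real" where
  "chord_max d a v = Max ((\<lambda>i. chord a i v) ` {1..<d})"

text \<open>The correction to the parabola vanishes at both nodes, so comparing two chords at
  \<open>v\<close> reduces to the signs of two products.\<close>

lemma chord_eq: "chord a i v = v\<^sup>2 / 2 - (v - a i) * (v - a (i + 1)) / 2"
  by (simp add: chord_def power2_eq_square field_simps)

text \<open>Induction on \<open>d\<close>: a point beyond \<open>a n\<close> lies in the newly added
  interval, any other point is covered by the induction hypothesis.\<close>

lemma consecutive_interval_cover: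
  fixes a :: "nat \<Rightarrow> real"
  assumes "d \<ge> 2" "a 1 \<le> v" "v \<le> a d"
  shows "\<exists>i. 1 \<le> i \<and> i < d \<and> v \<in> {a i..a (i + 1)}"
  using assms
proof (induction d rule: dec_induct)
  case base
  then show ?case by (intro exI[of _ 1]) (simp add: numeral_2_eq_2)
next
  case (step n)
  show ?case
  proof (cases "v \<le> a n")
    case True
    with step obtain i where "1 \<le> i \<and> i < n \<and> v \<in> {a i..a (i + 1)}" by auto
    then show ?thesis by (intro exI[of _ i]) auto
  next
    case False
    with step show ?thesis by (intro exI[of _ n]) auto
  qed
qed

text \<open>On \<open>[a i, a (i + 1)]\<close> the chord \<open>i\<close> lies above the parabola, and all other chords below it.\<close>

lemma multibang_eq_chord_max:
  assumes d: "d \<ge> 2" and a: "strict_mono_on {1..d} a" and v: "a 1 \<le> v" "v \<le> a d"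
  shows "multibang d a v = ereal (chord_max d a v)"
proof -
  obtain i where i: "1 \<le> i" "i < d" and vi: "v \<in> {a i..a (i + 1)}"
    using consecutive_interval_cover[of d a v, OF d v] by auto
  have le: "a j \<le> a k" if "1 \<le> j" "j \<le> k" "k \<le> d" for j k
    using strict_mono_on_leD[OF a, of j k] that by auto
  have "chord a j v \<le> chord a i v" if j: "1 \<le> j" "j < d" for j
  proof (cases j i rule: linorder_cases)
    case less
    then have "a j \<le> v" "a (j + 1) \<le> v"
      using le[of j i] le[of "j + 1" i] i j vi by auto
    then have "0 \<le> (v - a j) * (v - a (j + 1))" by simp
    moreover have "(v - a i) * (v - a (i + 1)) \<le> 0"
      using vi by (simp add: mult_nonneg_nonpos)
    ultimately show ?thesis by (simp add: chord_eq)
  next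
    case greater
    then have "v \<le> a j" "v \<le> a (j + 1)"
      using le[of "i + 1" j] le[of "i + 1" "j + 1"] i j vi by auto
    then have "0 \<le> (v - a j) * (v - a (j + 1))" by (simp add: mult_nonpos_nonpos)
    moreover have "(v - a i) * (v - a (i + 1)) \<le> 0"
      using vi by (simp add: mult_nonneg_nonpos)
    ultimately show ?thesis by (simp add: chord_eq)
  qed simp
  then have "chord_max d a v = chord a i v"
    unfolding chord_max_def using i by (intro Max_eqI) auto
  then show ?thesis
    using multibang_eq[OF a i vi] by (simp add: chord_def)
qed

text \<open>Every chord is affine, hence satisfies the relation with equality, and its two values on
  the right are at most the maxima.\<close>

lemma chord_max_convex:
  assumes d: "d \<ge> 2" and t: "0 \<le> t" "t \<le> 1"
  shows "chord_max d a (v + t * (w - v)) \<le> (1 - t) * chord_max d a v + t * chord_max d a w"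
proof -
  have "chord a i (v + t * (w - v)) \<le> (1 - t) * chord_max d a v + t * chord_max d a w"
    if "i \<in> {1..<d}" for i
  proof -
    have "chord a i (v + t * (w - v)) = (1 - t) * chord a i v + t * chord a i w"
      by (simp add: chord_def field_simps)
    moreover have "chord a i v \<le> chord_max d a v" "chord a i w \<le> chord_max d a w"
      unfolding chord_max_def using that by (auto intro!: Max_ge)
    ultimately show ?thesis
      using t by (simp add: add_mono mult_left_mono)
  qed
  then show ?thesis
    unfolding chord_max_def[of d a "v + t * (w - v)"] using d by (subst Max_le_iff) auto
qed

lemma chord_max_measurable [measurable]: "chord_max d a \<in> borel_measurable borel"
  unfolding chord_max_def chord_def by (rule borel_measurable_Max) auto

lemma chord_max_bounded:
  assumes d: "d \<ge> 2"
  obtains C where "\<And>v. a 1 \<le> v \<Longrightarrow> v \<le> a d \<Longrightarrow> \<bar>chord_max d a v\<bar> \<le> C"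
proof -
  \<comment> \<open>\<open>b i\<close> bounds chord \<open>i\<close> because |v| \<le> |a 1| + |a d|
    on the interval. Summing over \<open>i\<close> makes the bound independent of which chord is
    maximal at \<open>v\<close>.\<close>
  define b where "b i = \<bar>a i + a (i + 1)\<bar> * (\<bar>a 1\<bar> + \<bar>a d\<bar>) + \<bar>a i * a (i + 1)\<bar>" for i
  have b0: "0 \<le> b i" for i by (simp add: b_def)
  have "\<bar>chord_max d a v\<bar> \<le> (\<Sum>i=1..<d. b i)" if v: "a 1 \<le> v" "v \<le> a d" for v
  proof -
    have "chord_max d a v \<in> (\<lambda>i. chord a i v) ` {1..<d}"
      unfolding chord_max_def using d by (intro Max_in) auto
    then obtain i where i: "i \<in> {1..<d}" "chord_max d a v = chord a i v" by auto
    have abs_half_diff: "\<bar>1/2 * (s - t)\<bar> \<le> A + \<bar>t\<bar>" if "\<bar>s\<bar> \<le> A" for s t A :: real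
      using that abs_triangle_ineq4[of s t] abs_ge_zero[of "s - t"] by (simp add: abs_mult)
    have "\<bar>(a i + a (i + 1)) * v\<bar> \<le> \<bar>a i + a (i + 1)\<bar> * (\<bar>a 1\<bar> + \<bar>a d\<bar>)"
      unfolding abs_mult using v by (intro mult_left_mono) auto
    then have "\<bar>chord a i v\<bar> \<le> b i"
      unfolding chord_def b_def by (rule abs_half_diff)
    also have "\<dots> \<le> (\<Sum>i=1..<d. b i)"
      using i b0 by (intro member_le_sum) auto
    finally show ?thesis using i by simp
  qed
  then show ?thesis using that by blast
qed

section \<open>The integral functional on the admissible set\<close>

lemma U_ad_chord_max_integrable:
  assumes "\<Omega> \<in> lmeasurable" "d \<ge> 2" and u: "u \<in> U_ad \<Omega> d a"
  shows "integrable (lebesgue_on \<Omega>) (\<lambda>x. chord_max d a (u x))"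
proof -
  interpret finite_measure "lebesgue_on \<Omega>"
    using assms(1) by (rule finite_measure_lebesgue_on)
  obtain C where C: "\<And>v. a 1 \<le> v \<Longrightarrow> v \<le> a d \<Longrightarrow> \<bar>chord_max d a v\<bar> \<le> C"
    using chord_max_bounded[OF assms(2)] by blast
  have [measurable]: "u \<in> borel_measurable (lebesgue_on \<Omega>)"
    using u by (auto simp: U_ad_def L2_def)
  show ?thesis
  proof (rule integrable_const_bound[where B = C])
    have "AE x in lebesgue_on \<Omega>. a 1 \<le> u x \<and> u x \<le> a d"
      using u by (simp add: U_ad_def)
    then show "AE x in lebesgue_on \<Omega>. norm (chord_max d a (u x)) \<le> C"
      by eventually_elim (simp add: C)
  qed measurable
qed

text \<open>Replacing the integrand almost everywhere turns the extended-valued functional into an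
  ordinary integral, so that on \<open>U_ad\<close> the objective is a real number.\<close>

lemma multibang_integral_eq:
  assumes "\<Omega> \<in> lmeasurable" "d \<ge> 2" "strict_mono_on {1..d} a" and u: "u \<in> U_ad \<Omega> d a"
  shows "multibang_integral \<Omega> d a u = ereal (\<integral>x. chord_max d a (u x) \<partial>(lebesgue_on \<Omega>))"
proof -
  let ?M = "lebesgue_on \<Omega>"
  note int = U_ad_chord_max_integrable[OF assms(1,2) u]
  have ae: "AE x in ?M. multibang d a (u x) = ereal (chord_max d a (u x))"
  proof -
    have "AE x in ?M. a 1 \<le> u x \<and> u x \<le> a d"
      using u by (simp add: U_ad_def)
    then show ?thesis
      by eventually_elim (use multibang_eq_chord_max[OF assms(2,3)] in blast)
  qed
  have pos: "(\<integral>\<^sup>+x. e2ennreal (multibang d a (u x)) \<partial>?M) = (\<integral>\<^sup>+x. ennreal (chord_max d a (u x)) \<partial>?M)"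
    by (rule nn_integral_cong_AE) (use ae in \<open>eventually_elim, simp add: e2ennreal_ereal\<close>)
  have neg: "(\<integral>\<^sup>+x. e2ennreal (- multibang d a (u x)) \<partial>?M) = (\<integral>\<^sup>+x. ennreal (- chord_max d a (u x)) \<partial>?M)"
    by (rule nn_integral_cong_AE) (use ae in \<open>eventually_elim, simp add: e2ennreal_ereal\<close>)
  have fin: "(\<integral>\<^sup>+x. ennreal (chord_max d a (u x)) \<partial>?M) \<noteq> \<infinity>"
    "(\<integral>\<^sup>+x. ennreal (- chord_max d a (u x)) \<partial>?M) \<noteq> \<infinity>"
    using int by (simp_all add: real_integrable_def)
  \<comment> \<open>Finiteness of both parts rules out infinite terms, so the extended difference is
    the real one.\<close>
  have "enn2ereal s - enn2ereal t = ereal (enn2real s - enn2real t)"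
    if "s \<noteq> \<infinity>" "t \<noteq> \<infinity>" for s t
    using that by (cases s; cases t) (auto simp: enn2ereal_ennreal)
  then show ?thesis
    unfolding multibang_integral_def pos neg real_lebesgue_integral_def[OF int]
    using fin by simp
qed

lemma U_ad_convex:
  assumes u: "u \<in> U_ad \<Omega> d a" and w: "w \<in> U_ad \<Omega> d a" and t: "0 \<le> t" "t \<le> 1"
  shows "(\<lambda>x. u x + t * (w x - u x)) \<in> U_ad \<Omega> d a"
proof -
  have L2: "u \<in> L2 \<Omega>" "w \<in> L2 \<Omega>" using u w by (auto simp: U_ad_def)
  have "AE x in lebesgue_on \<Omega>. a 1 \<le> u x \<and> u x \<le> a d"
    "AE x in lebesgue_on \<Omega>. a 1 \<le> w x \<and> w x \<le> a d"
    using u w by (auto simp: U_ad_def)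
  then have "AE x in lebesgue_on \<Omega>. a 1 \<le> u x + t * (w x - u x) \<and> u x + t * (w x - u x) \<le> a d"
  proof eventually_elim
    case (elim x)
    have "u x + t * (w x - u x) = (1 - t) * u x + t * w x" by (simp add: algebra_simps)
    moreover have "(1 - t) * a 1 + t * a 1 \<le> (1 - t) * u x + t * w x"
      "(1 - t) * u x + t * w x \<le> (1 - t) * a d + t * a d"
      using elim t by (intro add_mono mult_left_mono; simp)+
    ultimately show ?case by (simp add: algebra_simps)
  qed
  then show ?thesis
    using L2_add[OF L2(1) L2_scale[OF L2_diff[OF L2(2,1)]]] by (simp add: U_ad_def)
qed

section \<open>First-order optimality\<close>

text \<open>For small \<open>t\<close> the linear term dominates. This replaces dividing by
  \<open>t\<close> and passing to the limit.\<close>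

lemma nonneg_if_quadratic_nonneg:
  fixes A B :: real
  assumes "\<And>t. 0 < t \<Longrightarrow> t \<le> 1 \<Longrightarrow> 0 \<le> t * A + t\<^sup>2 * B"
  shows "0 \<le> A"
proof (rule ccontr)
  assume A: "\<not> 0 \<le> A"
  \<comment> \<open>Chosen so that \<open>t * B\<close> is at most half of \<open>- A\<close>; the
    summand 1 keeps the denominator positive when \<open>B = 0\<close>.\<close>
  define t where "t = min 1 (- A / (2 * (\<bar>B\<bar> + 1)))"
  have t: "0 < t" "t \<le> 1" using A by (auto simp: t_def divide_neg_pos)
  have "t * (\<bar>B\<bar> + 1) \<le> - A / (2 * (\<bar>B\<bar> + 1)) * (\<bar>B\<bar> + 1)"
    unfolding t_def by (intro mult_right_mono) auto
  also have "\<dots> = - A / 2" by (simp add: field_simps)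
  finally have "t * B \<le> - A / 2"
    using t mult_left_mono[of B "\<bar>B\<bar> + 1" t] by linarith
  then have "A + t * B < 0" using A by linarith
  then have "t * (A + t * B) < 0" using t by (simp add: mult_pos_neg)
  then show False using assms[OF t] by (simp add: power2_eq_square algebra_simps)
qed

text \<open>Compare \<open>u\<close> with \<open>u + t * (w - u)\<close>. The two quadratic terms
  expand exactly in \<open>t\<close>, while \<open>G\<close> is only bounded through convexity;
  hence the difference quotient \<open>G w - G u\<close> appears and no derivative of
  \<open>G\<close>.\<close>

lemma variational_inequality:
  fixes K :: "('a::euclidean_space \<Rightarrow> real) \<Rightarrow> 'y::real_inner"
  assumes \<Omega>: "\<Omega> \<in> lmeasurable" and K: "L2_bounded_linear \<Omega> K" and \<alpha>: "\<alpha> \<ge> 0"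
    and d: "d \<ge> 2" and a: "strict_mono_on {1..d} a"
    and sol: "is_solution \<Omega> d a K z \<alpha> \<gamma> u" and w: "w \<in> U_ad \<Omega> d a"
  defines "G \<equiv> \<lambda>v. \<integral>x. chord_max d a (v x) \<partial>(lebesgue_on \<Omega>)"
  shows "0 \<le> (K u - z) \<bullet> (K w - K u) + \<alpha> * (G w - G u) + \<gamma> * L2_inner \<Omega> u (\<lambda>x. w x - u x)"
proof (rule nonneg_if_quadratic_nonneg)
  let ?e = "\<lambda>x. w x - u x"
  let ?J = "\<lambda>v. 1/2 * (norm (K v - z))\<^sup>2 + \<alpha> * G v + \<gamma>/2 * (L2_norm \<Omega> v)\<^sup>2"
  have u: "u \<in> U_ad \<Omega> d a" and min: "\<And>v. v \<in> U_ad \<Omega> d a \<Longrightarrow>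
      objective \<Omega> d a K z \<alpha> \<gamma> u \<le> objective \<Omega> d a K z \<alpha> \<gamma> v"
    using sol by (auto simp: is_solution_def is_arg_min_def not_less)
  have obj: "objective \<Omega> d a K z \<alpha> \<gamma> v = ereal (?J v)" if "v \<in> U_ad \<Omega> d a" for v
    using multibang_integral_eq[OF \<Omega> d a that] by (simp add: objective_def G_def)
  have uL: "u \<in> L2 \<Omega>" and wL: "w \<in> L2 \<Omega>" using u w by (auto simp: U_ad_def)
  note eL = L2_diff[OF wL uL]
  fix t :: real assume t: "0 < t" "t \<le> 1"
  let ?v = "\<lambda>x. u x + t * ?e x"
  have v: "?v \<in> U_ad \<Omega> d a" using U_ad_convex[OF u w] t by simp
  have "G ?v \<le> (\<integral>x. (1 - t) * chord_max d a (u x) + t * chord_max d a (w x) \<partial>(lebesgue_on \<Omega>))"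
    unfolding G_def using t
    by (intro integral_mono U_ad_chord_max_integrable[OF \<Omega> d v] chord_max_convex d
        Bochner_Integration.integrable_add integrable_mult_right
        U_ad_chord_max_integrable[OF \<Omega> d u] U_ad_chord_max_integrable[OF \<Omega> d w]) auto
  also have "\<dots> = (1 - t) * G u + t * G w"
    unfolding G_def using U_ad_chord_max_integrable[OF \<Omega> d u] U_ad_chord_max_integrable[OF \<Omega> d w]
    by simp
  finally have Gv: "\<alpha> * G ?v \<le> \<alpha> * ((1 - t) * G u + t * G w)"
    using \<alpha> by (rule mult_left_mono)
  have Kv: "K ?v - z = (K u - z) + t *\<^sub>R (K w - K u)"
    using L2_bounded_linear_add_scale[OF K uL eL] L2_bounded_linear_diff[OF K wL uL] by simp
  have Kn: "(norm (K ?v - z))\<^sup>2 =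
      (norm (K u - z))\<^sup>2 + 2 * t * ((K u - z) \<bullet> (K w - K u)) + t\<^sup>2 * (norm (K w - K u))\<^sup>2"
    unfolding Kv power2_norm_eq_inner
    by (simp only: inner_add_left inner_add_right inner_scaleR_left inner_scaleR_right
        inner_commute[of "K w - K u" "K u - z"] power2_eq_square) (simp add: algebra_simps)
  \<comment> \<open>The terms of order zero in \<open>t\<close> cancel here, which leaves a linear
    and a quadratic term.\<close>
  have "?J u \<le> ?J ?v"
    using min[OF v] unfolding obj[OF u] obj[OF v] by simp
  then show "0 \<le> t * ((K u - z) \<bullet> (K w - K u) + \<alpha> * (G w - G u) + \<gamma> * L2_inner \<Omega> u ?e)
      + t\<^sup>2 * (1/2 * (norm (K w - K u))\<^sup>2 + \<gamma>/2 * (L2_norm \<Omega> ?e)\<^sup>2)"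
    unfolding Kn L2_norm_power2_add_scale[OF uL eL] using Gv by (simp add: algebra_simps)
qed

section \<open>The error estimate\<close>

text \<open>The second operator \<open>H\<close> is arbitrary, so that \<open>H = K\<close> covers
  the case \<open>h = 0\<close>, and the two consistency errors stay separate.\<close>

lemma solution_error_bound:
  fixes K H :: "('a::euclidean_space \<Rightarrow> real) \<Rightarrow> 'y::real_inner"
  assumes \<Omega>: "\<Omega> \<in> lmeasurable" and \<alpha>: "\<alpha> \<ge> 0" and \<gamma>: "\<gamma> > 0"
    and d: "d \<ge> 2" and a: "strict_mono_on {1..d} a"
    and K: "L2_bounded_linear \<Omega> K" "is_L2_adjoint \<Omega> K K'"
    and H: "L2_bounded_linear \<Omega> H" "is_L2_adjoint \<Omega> H H'"
    and u: "is_solution \<Omega> d a K z \<alpha> \<gamma> u" and v: "is_solution \<Omega> d a H z \<alpha> \<gamma> v"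
  shows "(norm (K u - H v))\<^sup>2 + \<gamma> * (L2_norm \<Omega> (\<lambda>x. u x - v x))\<^sup>2
    \<le> (norm (K v - H v))\<^sup>2 + inverse \<gamma> * (L2_norm \<Omega> (\<lambda>x. K' (H v - z) x - H' (H v - z) x))\<^sup>2"
proof -
  let ?e = "\<lambda>x. v x - u x"
  let ?f = "\<lambda>x. K' (H v - z) x - H' (H v - z) x"
  have ad: "u \<in> U_ad \<Omega> d a" "v \<in> U_ad \<Omega> d a"
    using u v by (auto simp: is_solution_def is_arg_min_def)
  then have uL: "u \<in> L2 \<Omega>" and vL: "v \<in> L2 \<Omega>" by (auto simp: U_ad_def)
  note eL = L2_diff[OF vL uL]
  have K'L: "K' y \<in> L2 \<Omega>" and H'L: "H' y \<in> L2 \<Omega>" for y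
    using K(2) H(2) by (auto simp: is_L2_adjoint_def)
  note fL = L2_diff[OF K'L H'L, of "H v - z" "H v - z"]
  have e2: "(L2_norm \<Omega> (\<lambda>x. u x - v x))\<^sup>2 = (L2_norm \<Omega> ?e)\<^sup>2"
    by (simp add: L2_norm_power2 L2_inner_def algebra_simps)
  have inn: "L2_inner \<Omega> u ?e + L2_inner \<Omega> v (\<lambda>x. u x - v x) = - (L2_norm \<Omega> ?e)\<^sup>2"
    using L2_norm_power2_add_scale[OF vL uL, of "-1"] uL vL
    by (simp add: L2_inner_diff_right L2_norm_power2 L2_inner_commute[of \<Omega> v u])
  \<comment> \<open>Both operators act on the same difference \<open>?e\<close> and are tested with
    the same residual \<open>H v - z\<close>; moving them over leaves only the difference of the
    adjoints.\<close>
  have adj: "(H v - z) \<bullet> ((K v - K u) - (H v - H u)) = L2_inner \<Omega> ?f ?e"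
  proof -
    have "(K v - K u) \<bullet> (H v - z) = L2_inner \<Omega> ?e (K' (H v - z))"
      using K(2) eL unfolding is_L2_adjoint_def L2_bounded_linear_diff[OF K(1) vL uL, symmetric]
      by blast
    moreover have "(H v - H u) \<bullet> (H v - z) = L2_inner \<Omega> ?e (H' (H v - z))"
      using H(2) eL unfolding is_L2_adjoint_def L2_bounded_linear_diff[OF H(1) vL uL, symmetric]
      by blast
    ultimately show ?thesis
      using L2_inner_diff_right[OF eL K'L H'L, of "H v - z" "H v - z"]
      by (metis L2_inner_commute inner_commute inner_diff_left)
  qed
  \<comment> \<open>Sum of the two variational inequalities: the \<open>G\<close> differences are
    opposite, and the \<gamma> terms combine by \<open>inn\<close>.\<close>
  have "0 \<le> (K u - z) \<bullet> (K v - K u) + (H v - z) \<bullet> (H u - H v) - \<gamma> * (L2_norm \<Omega> ?e)\<^sup>2"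
    using variational_inequality[OF \<Omega> K(1) \<alpha> d a u ad(2)]
      variational_inequality[OF \<Omega> H(1) \<alpha> d a v ad(1)] arg_cong[OF inn, of "(*) \<gamma>"]
    by (simp add: algebra_simps)
  \<comment> \<open>Split \<open>K u - z\<close> into \<open>K u - H v\<close> and
    \<open>H v - z\<close>, then write \<open>K v - K u\<close> in the first product as
    \<open>(K v - H v) - (K u - H v)\<close>.\<close>
  also have "(K u - z) \<bullet> (K v - K u) + (H v - z) \<bullet> (H u - H v) =
      (K u - H v) \<bullet> (K v - H v) - (norm (K u - H v))\<^sup>2 + (H v - z) \<bullet> ((K v - K u) - (H v - H u))"
    by (simp add: power2_norm_eq_inner inner_diff_left inner_diff_right inner_commute)
  finally have "(norm (K u - H v))\<^sup>2 + \<gamma> * (L2_norm \<Omega> ?e)\<^sup>2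
      \<le> (K u - H v) \<bullet> (K v - H v) + L2_inner \<Omega> ?f ?e"
    unfolding adj by simp
  \<comment> \<open>After doubling the estimate, the two Young inequalities use up exactly one of
    the two copies of the left-hand side, so the final constant is 1.\<close>
  moreover have "2 * ((K u - H v) \<bullet> (K v - H v)) \<le> (norm (K u - H v))\<^sup>2 + (norm (K v - H v))\<^sup>2"
    using norm_cauchy_schwarz[of "K u - H v" "K v - H v"]
      sum_squares_bound[of "norm (K u - H v)" "norm (K v - H v)"] by linarith
  moreover note L2_inner_Young[OF fL eL \<gamma>]
  ultimately show ?thesis
    unfolding e2 by linarith
qed

theorem theorem4p1:
  fixes \<Omega> :: "(real ^ 'n) set"
    and K :: "((real ^ 'n) \<Rightarrow> real) \<Rightarrow> 'y :: {real_inner, complete_space}"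
    and K_adj :: "'y \<Rightarrow> (real ^ 'n) \<Rightarrow> real"
    and Kh :: "real \<Rightarrow> ((real ^ 'n) \<Rightarrow> real) \<Rightarrow> 'y"
    and Kh_adj :: "real \<Rightarrow> 'y \<Rightarrow> (real ^ 'n) \<Rightarrow> real"
    and z :: 'y
    and \<alpha> :: real
    and d :: nat
    and a :: "nat \<Rightarrow> real"
    and u :: "real \<Rightarrow> (real ^ 'n) \<Rightarrow> real"
    and uh :: "real \<Rightarrow> real \<Rightarrow> (real ^ 'n) \<Rightarrow> real"
    and \<delta> :: "real \<Rightarrow> real"
  assumes "open \<Omega>" and "connected \<Omega>" and "\<Omega> \<noteq> {}" and "bounded \<Omega>"
    and "L2_bounded_linear \<Omega> K" and "is_L2_adjoint \<Omega> K K_adj"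
    and "\<alpha> > 0"
    and "d \<ge> 2" and "strict_mono_on {1..d} a"
    and "\<And>h. h > 0 \<Longrightarrow> L2_bounded_linear \<Omega> (Kh h)"
    and "\<And>h. h > 0 \<Longrightarrow> finite_dim_range \<Omega> (Kh h)"
    and "\<And>h. h > 0 \<Longrightarrow> is_L2_adjoint \<Omega> (Kh h) (Kh_adj h)"
    and "Kh 0 = K"
    and "\<And>\<gamma>. \<gamma> > 0 \<Longrightarrow> is_solution \<Omega> d a K z \<alpha> \<gamma> (u \<gamma>)"
    and "\<And>\<gamma> h. \<gamma> > 0 \<Longrightarrow> h \<ge> 0 \<Longrightarrow> is_solution \<Omega> d a (Kh h) z \<alpha> \<gamma> (uh \<gamma> h)"
    and "mono_on {0..} \<delta>" and "\<delta> 0 = 0"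
    and "\<And>\<gamma> h. \<gamma> > 0 \<Longrightarrow> h > 0 \<Longrightarrow>
           norm (K (uh \<gamma> h) - Kh h (uh \<gamma> h))
             + L2_norm \<Omega> (\<lambda>x. K_adj (Kh h (uh \<gamma> h) - z) x - Kh_adj h (Kh h (uh \<gamma> h) - z) x)
           \<le> \<delta> h"
  shows "\<forall>\<gamma>>0. \<forall>h\<ge>0.
           (norm (K (u \<gamma>) - Kh h (uh \<gamma> h)))\<^sup>2 + \<gamma> * (L2_norm \<Omega> (\<lambda>x. u \<gamma> x - uh \<gamma> h x))\<^sup>2
           \<le> (1 + inverse \<gamma>) * (\<delta> h)\<^sup>2"
proof (intro allI impI)
  fix \<gamma> h :: real assume \<gamma>: "\<gamma> > 0" and h: "h \<ge> 0"
  have \<Omega>: "\<Omega> \<in> lmeasurable"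
    using assms(1,4) by (simp add: lmeasurable_open)
  note bound = solution_error_bound[OF \<Omega> less_imp_le[OF assms(7)] \<gamma> assms(8,9) assms(5,6)
      _ _ assms(14)[OF \<gamma>] assms(15)[OF \<gamma> h]]
  show "(norm (K (u \<gamma>) - Kh h (uh \<gamma> h)))\<^sup>2 + \<gamma> * (L2_norm \<Omega> (\<lambda>x. u \<gamma> x - uh \<gamma> h x))\<^sup>2
      \<le> (1 + inverse \<gamma>) * (\<delta> h)\<^sup>2"
  proof (cases "h = 0")
    case True
    \<comment> \<open>The consistency estimate is assumed only for positive \<open>h\<close>. Here
      \<open>K_adj\<close> serves as adjoint of \<open>Kh 0 = K\<close>, so both errors vanish and
      the bound is 0.\<close>
    then show ?thesis
      using bound[of K_adj] assms(5,6,13,17) by (simp add: L2_norm_def L2_inner_def)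
  next
    case False
    with h have h: "h > 0" by simp
    let ?p = "norm (K (uh \<gamma> h) - Kh h (uh \<gamma> h))"
    let ?q = "L2_norm \<Omega> (\<lambda>x. K_adj (Kh h (uh \<gamma> h) - z) x - Kh_adj h (Kh h (uh \<gamma> h) - z) x)"
    have "?p + ?q \<le> \<delta> h" "0 \<le> ?p" "0 \<le> ?q"
      using assms(18)[OF \<gamma> h] L2_norm_nonneg by auto
    \<comment> \<open>Both errors are nonnegative, so the bound on their sum bounds each of
      them.\<close>
    then have "?p\<^sup>2 \<le> (\<delta> h)\<^sup>2" "?q\<^sup>2 \<le> (\<delta> h)\<^sup>2"
      by (intro power_mono; linarith)+
    then have "?p\<^sup>2 + inverse \<gamma> * ?q\<^sup>2 \<le> (1 + inverse \<gamma>) * (\<delta> h)\<^sup>2"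
      using \<gamma> by (simp add: distrib_right add_mono)
    then show ?thesis
      using bound[OF assms(10)[OF h] assms(12)[OF h]] by linarith
  qed
qed

end
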